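(* Let $n\geq 2$ and let $A=[a_{ij}]\in \mathbb{C}^{n\times n}$ be a DD matrix. Then $A$ is an H-matrix if and only if $A$ has nonzero diagonal entries and $T(A)$ is an interwoven set of indices for $A$ (equivalently, if and only if $T(A)=\emptyset$ or for each $i_0\in T(A)$ there exists a nonzero elements chain of the form $a_{i_0i_1},a_{i_1i_2},\ldots,a_{i_{r-1}i_r}$ with $i_r\in\overline{T(A)}$).
   Context: Let $N=\{1,2,\ldots,n\}$ and, for $S\subseteq N$, let $\overline{S}=N\setminus S$. For $A=[a_{ij}]\in\mathbb{C}^{n\times n}$ and $i\in N$, put $r_i(A)=\sum_{j\in N\setminus\{i\}}|a_{ij}|$. The matrix $A$ is SDD (strictly diagonally dominant) if $|a_{ii}|>r_i(A)$ for all $i\in N$, and DD (diagonally dominant) if $|a_{ii}|\geq r_i(A)$ for all $i\in N$. Let $T(A)=\{i\in N : |a_{ii}|\leq r_i(A)\}$. A square complex matrix $A$ is an H-matrix if there exists a diagonal matrix $D$ with positive diagonal entries such that $AD$ is SDD (equivalently, its comparison matrix, with diagonal entries $|a_{ii}|$ and off-diagonal entries $-|a_{ij}|$, is a nonsingular M-matrix). A nonzero elements chain $a_{i_0i_1},a_{i_1i_2},\ldots,a_{i_{r-1}i_r}$ (with $r\ge 1$) is a sequence of entries of $A$ all of which are nonzero; that is, there is a path from $i_0$ to $i_r$ in the directed graph of $A$ (vertices $N$, an edge from $i$ to $j$ whenever $a_{ij}\neq 0$). A proper subset $S$ of $N$ (possibly empty, $S\ne N$) is called interwoven for the matrix $A$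 if $|S|\leq 1$, or $|S|=s>1$ and there exist distinct numbers $p_1,p_2,\ldots,p_{s-1}\in S$ and (not necessarily distinct) numbers $q_1,q_2,\ldots,q_{s-1}$ such that $q_1\in\overline{S}$, $a_{p_1q_1}\neq 0$, and for every $i\in\{2,3,\ldots,s-1\}$, $q_i\in\overline{S}\cup\{p_1,p_2,\ldots,p_{i-1}\}$ and $a_{p_iq_i}\neq 0$. (Saying that $T(A)$ is interwoven includes that $T(A)$ is a proper subset of $N$.) *)

theory Defs
  imports "HOL-Analysis.Analysis"
begin

text \<open>The index set \<open>N = {1, \<dots>, n}\<close> is the finite type \<open>'n\<close>, so \<open>n = CARD('n)\<close>,
  \<open>N = UNIV\<close>, and the complement of \<open>S\<close> in \<open>N\<close> is \<open>- S\<close>.\<close>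

definition row_sum :: "complex ^ 'n ^ 'n \<Rightarrow> 'n::finite \<Rightarrow> real" where
  "row_sum A i = (\<Sum>j\<in>UNIV - {i}. norm (A $ i $ j))"

definition SDD :: "complex ^ 'n ^ 'n::finite \<Rightarrow> bool" where
  "SDD A \<longleftrightarrow> (\<forall>i. norm (A $ i $ i) > row_sum A i)"

definition DD :: "complex ^ 'n ^ 'n::finite \<Rightarrow> bool" where
  "DD A \<longleftrightarrow> (\<forall>i. norm (A $ i $ i) \<ge> row_sum A i)"

definition T_set :: "complex ^ 'n ^ 'n \<Rightarrow> 'n::finite set" where
  "T_set A = {i. norm (A $ i $ i) \<le> row_sum A i}"

definition pos_diagonal :: "complex ^ 'n ^ 'n::finite \<Rightarrow> bool" where
  "pos_diagonal D \<longleftrightarrow>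
     (\<forall>i j. i \<noteq> j \<longrightarrow> D $ i $ j = 0) \<and> (\<forall>i. D $ i $ i \<in> \<real> \<and> Re (D $ i $ i) > 0)"

definition H_matrix :: "complex ^ 'n ^ 'n::finite \<Rightarrow> bool" where
  "H_matrix A \<longleftrightarrow> (\<exists>D. pos_diagonal D \<and> SDD (A ** D))"

definition nonzero_chain :: "complex ^ 'n ^ 'n \<Rightarrow> 'n::finite \<Rightarrow> 'n \<Rightarrow> bool" where
  "nonzero_chain A i j \<longleftrightarrow>
     (\<exists>(r::nat) (c :: nat \<Rightarrow> 'n). r \<ge> 1 \<and> c 0 = i \<and> c r = j \<and>
        (\<forall>k<r. A $ c k $ c (Suc k) \<noteq> 0))"

text \<open>The sequences \<open>p\<close> and \<open>q\<close> are functions on \<open>nat\<close> of which only the values at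
  \<open>1, \<dots>, s - 1\<close> are used, where \<open>s = card S\<close>. At index \<open>1\<close> the set of earlier
  terms \<open>p ` {1..<1}\<close> is empty, but the condition on \<open>q 1\<close> is spelled out separately.\<close>

definition interwoven :: "complex ^ 'n ^ 'n \<Rightarrow> 'n::finite set \<Rightarrow> bool" where
  "interwoven A S \<longleftrightarrow> S \<subset> UNIV \<and>
     (card S \<le> 1 \<or>
      card S > 1 \<and>
      (\<exists>(p :: nat \<Rightarrow> 'n) (q :: nat \<Rightarrow> 'n).
         inj_on p {1..card S - 1} \<and> p ` {1..card S - 1} \<subseteq> S \<and>
         q 1 \<in> - S \<and> A $ p 1 $ q 1 \<noteq> 0 \<and>
         (\<forall>i\<in>{2..card S - 1}.
            q i \<in> - S \<union> p ` {1..<i} \<and> A $ p i $ q i \<noteq> 0)))"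

end

theory Submission
  imports Defs
begin

text \<open>
  All the conditions of the theorem are equivalent to one property of the directed graph of \<open>A\<close>:
  no nonempty set \<open>U \<subseteq> T(A)\<close> is closed under outgoing edges, that is, every such \<open>U\<close> has an edge
  that leaves it (\<open>edges_leave\<close> below).

  If \<open>A\<close> is an H-matrix with scaling \<open>d\<close>, a closed \<open>U\<close> is impossible: in the row of an index of
  \<open>U\<close> with smallest \<open>d\<close>, the scaled off-diagonal entries sum to at least \<open>d i * row_sum A i\<close>, so
  strict dominance of the scaled row would force strict dominance of the original one
  (\<open>H_matrix_edges_leave\<close>).

  Conversely, repeatedly removing from \<open>T(A)\<close> an index with an edge out of what remains enumerates
  \<open>T(A)\<close> so that every index has an edge to something outside \<open>T(A)\<close> or earlier. This order is what
  interwovenness records. Its positions form a rank \<open>l\<close> which some edge at each index of \<open>T(A)\<close>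
  decreases, and then \<open>d j = 1 - \<epsilon> ^ (l j + 1)\<close> scales \<open>A\<close> to an SDD matrix for small \<open>\<epsilon> > 0\<close>
  (\<open>H_matrix_if_rank\<close>): in a row \<open>i\<close> in \<open>T(A)\<close>, what the scaling takes from the entry of a decreasing edge outweighs
  what it takes from the diagonal entry, while the rows outside \<open>T(A)\<close> have room for a small
  perturbation.

  Interwovenness orders only \<open>card T(A) - 1\<close> of the indices. The remaining one has an edge to some
  other index because a row in \<open>T(A)\<close> with nonzero diagonal entry has a nonzero
  off-diagonal entry. This is where the hypothesis on the diagonal enters.
\<close>

section \<open>Sets of vertices without closed subsets\<close>

definition edges_leave :: "('a \<Rightarrow> 'a \<Rightarrow> bool) \<Rightarrow> 'a set \<Rightarrow> bool" where
  "edges_leave E T \<longleftrightarrow> (\<forall>U\<subseteq>T. U \<noteq> {} \<longrightarrow> (\<exists>i\<in>U. \<exists>j\<in>- U. E i j))"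

text \<open>The first vertex can be any one with an edge that leaves \<open>T\<close>; the property passes to the rest
  of \<open>T\<close>, from which later vertices may also use edges to the one removed.\<close>

lemma edges_leave_enumeration:
  assumes "finite T" and "edges_leave E T"
  shows "\<exists>p. bij_betw p {1..card T} T \<and>
    (\<forall>k\<in>{1..card T}. \<exists>j. j \<notin> p ` {k..card T} \<and> E (p k) j)"
  using assms
proof (induction "card T" arbitrary: T)
  case 0
  then show ?case by (simp add: bij_betw_def)
next
  case (Suc s)
  from Suc.hyps have "T \<noteq> {}" by auto
  then obtain i j where ij: "i \<in> T" "j \<notin> T" "E i j"
    using Suc.prems(2) unfolding edges_leave_def by blast
  have card: "card (T - {i}) = s"
    using Suc ij by simp
  have "edges_leave E (T - {i})"
    using Suc.prems(2) unfolding edges_leave_def by blast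
  with Suc.hyps(1)[of "T - {i}"] Suc.prems(1) card obtain p where
    bij: "bij_betw p {1..s} (T - {i})" and
    edge: "\<And>k. k \<in> {1..s} \<Longrightarrow> \<exists>j. j \<notin> p ` {k..s} \<and> E (p k) j"
    by auto
  define p' where "p' k = (if k = 1 then i else p (k - 1))" for k
  have tail: "p' ` {Suc k..Suc s} = p ` {k..s}" if "k \<ge> 1" for k
  proof -
    have "p' ` {Suc k..Suc s} = p' ` Suc ` {k..s}" by simp
    also have "\<dots> = p ` {k..s}"
      unfolding image_image using that by (intro image_cong) (auto simp: p'_def)
    finally show ?thesis .
  qed
  have split: "{1..Suc s} = insert 1 {Suc 1..Suc s}" by auto
  have img: "p' ` {1..Suc s} = T"
    unfolding split image_insert tail[OF order_refl]
    using bij ij(1) by (auto simp: p'_def bij_betw_def)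
  have "inj_on p' {1..Suc s}"
    by (rule eq_card_imp_inj_on) (use img Suc.hyps(2) in auto)
  moreover have "\<exists>j. j \<notin> p' ` {k..Suc s} \<and> E (p' k) j" if k: "k \<in> {1..Suc s}" for k
  proof (cases "k = 1")
    case True
    then show ?thesis using ij img by (auto simp: p'_def)
  next
    case False
    with k obtain m where m: "k = Suc m" "m \<in> {1..s}"
      by (cases k) auto
    then show ?thesis using edge[of m] tail[of m] by (auto simp: p'_def)
  qed
  ultimately show ?case
    unfolding Suc.hyps(2)[symmetric] bij_betw_def using img by blast
qed

lemma edges_leave_rank:
  assumes "finite T" and "edges_leave E T"
  shows "\<exists>l :: 'a \<Rightarrow> nat. \<forall>i\<in>T. \<exists>j. l j < l i \<and> E i j"
proof -
  define s where "s = card T"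
  obtain p where bij: "bij_betw p {1..s} T" and
    edge: "\<And>k. k \<in> {1..s} \<Longrightarrow> \<exists>j. j \<notin> p ` {k..s} \<and> E (p k) j"
    using edges_leave_enumeration[OF assms] unfolding s_def by blast
  \<comment> \<open>Positions start at \<open>1\<close>, so rank \<open>0\<close> is free for the vertices outside \<open>T\<close>.\<close>
  define l where "l x = (if x \<in> T then inv_into {1..s} p x else 0)" for x
  have "\<exists>j. l j < l i \<and> E i j" if "i \<in> T" for i
  proof -
    from that bij obtain k where k: "k \<in> {1..s}" "i = p k"
      by (auto simp: bij_betw_def)
    have li: "l i = k"
      using that k bij by (simp add: l_def bij_betw_inv_into_left)
    from edge[OF k(1)] obtain j where j: "j \<notin> p ` {k..s}" "E i j"
      using k by auto
    have "l j < k"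
    proof (cases "j \<in> T")
      case True
      then have "l j \<in> {1..s}" "p (l j) = j"
        using bij inv_into_into[of j p "{1..s}"]
        by (simp_all add: l_def bij_betw_inv_into_right bij_betw_def)
      with j(1) show ?thesis
        by (metis atLeastAtMost_iff image_eqI not_le)
    next
      case False
      with k show ?thesis by (simp add: l_def)
    qed
    with j li show ?thesis by auto
  qed
  then show ?thesis by blast
qed

section \<open>Graph conditions on the matrix\<close>

abbreviation (input) matrix_edge :: "complex ^ 'n ^ 'n \<Rightarrow> 'n::finite \<Rightarrow> 'n \<Rightarrow> bool" where
  "matrix_edge A i j \<equiv> A $ i $ j \<noteq> 0"

lemma nonzero_chain_edge: "matrix_edge A i j \<Longrightarrow> nonzero_chain A i j"
  unfolding nonzero_chain_def
  by (rule exI[of _ 1], rule exI[of _ "\<lambda>k. if k = 0 then i else j"]) simp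

lemma nonzero_chain_step:
  assumes "matrix_edge A i j" and "nonzero_chain A j k"
  shows "nonzero_chain A i k"
proof -
  from assms(2) obtain r c where rc: "r \<ge> 1" "c 0 = j" "c r = k"
    "\<And>m. m < r \<Longrightarrow> A $ c m $ c (Suc m) \<noteq> 0"
    unfolding nonzero_chain_def by blast
  show ?thesis
    unfolding nonzero_chain_def
    by (rule exI[of _ "Suc r"], rule exI[of _ "case_nat i c"])
      (use rc assms(1) in \<open>auto simp: less_Suc_eq_0_disj\<close>)
qed

lemma nonzero_chain_leaves:
  assumes "nonzero_chain A i j" and "i \<in> U" and "j \<notin> U"
  shows "\<exists>i'\<in>U. \<exists>j'\<in>- U. matrix_edge A i' j'"
proof -
  from assms(1) obtain r c where rc: "c 0 = i" "c r = j"
    "\<And>m. m < r \<Longrightarrow> A $ c m $ c (Suc m) \<noteq> 0"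
    unfolding nonzero_chain_def by blast
  define m where "m = (LEAST m. c m \<notin> U)"
  have "c r \<notin> U" using rc(2) assms(3) by simp
  then have "c m \<notin> U" "m \<le> r"
    unfolding m_def by (rule LeastI, rule Least_le)
  moreover from this rc assms(2) obtain m' where "m = Suc m'"
    by (cases m) auto
  moreover from this have "c m' \<in> U"
    unfolding m_def using not_less_Least by (metis lessI)
  ultimately show ?thesis using rc(3)[of m'] by auto
qed

text \<open>The vertices of \<open>T\<close> from which no chain leads out of \<open>T\<close> form a closed set.\<close>

lemma edges_leave_iff_chains:
  "edges_leave (matrix_edge A) T \<longleftrightarrow> (\<forall>i\<in>T. \<exists>j\<in>- T. nonzero_chain A i j)"
proof
  assume leave: "edges_leave (matrix_edge A) T"
  define U where "U = {i \<in> T. \<forall>j\<in>- T. \<not> nonzero_chain A i j}"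
  have "U = {}"
  proof (rule ccontr)
    assume "U \<noteq> {}"
    moreover have "U \<subseteq> T" by (auto simp: U_def)
    ultimately obtain i j where "i \<in> U" "j \<notin> U" "matrix_edge A i j"
      using leave unfolding edges_leave_def by blast
    then show False
      unfolding U_def using nonzero_chain_edge nonzero_chain_step by blast
  qed
  then show "\<forall>i\<in>T. \<exists>j\<in>- T. nonzero_chain A i j" by (auto simp: U_def)
next
  assume chains: "\<forall>i\<in>T. \<exists>j\<in>- T. nonzero_chain A i j"
  show "edges_leave (matrix_edge A) T"
    unfolding edges_leave_def
  proof (intro allI impI)
    fix U assume U: "U \<subseteq> T" "U \<noteq> {}"
    then obtain i where "i \<in> U" by blast
    with U chains obtain j where "nonzero_chain A i j" "j \<notin> U" by blast
    with \<open>i \<in> U\<close> show "\<exists>i\<in>U. \<exists>j\<in>- U. matrix_edge A i j"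
      using nonzero_chain_leaves by blast
  qed
qed

lemma edges_leave_interwoven:
  fixes T :: "'n::finite set"
  assumes "edges_leave (matrix_edge A) T"
  shows "interwoven A T"
proof -
  define s where "s = card T"
  have "T \<noteq> UNIV"
    using assms unfolding edges_leave_def by fastforce
  then have proper: "T \<subset> UNIV" by auto
  have "edges_leave (matrix_edge A) T" "finite T" using assms by auto
  from edges_leave_enumeration[OF this(2,1)] obtain p where
    bij: "bij_betw p {1..s} T" and
    edge: "\<forall>k\<in>{1..s}. \<exists>j. j \<notin> p ` {k..s} \<and> A $ p k $ j \<noteq> 0"
    unfolding s_def by blast
  from bchoice[OF edge] obtain q where
    q: "\<And>k. k \<in> {1..s} \<Longrightarrow> q k \<notin> p ` {k..s} \<and> A $ p k $ q k \<noteq> 0"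
    by blast
  have inj: "inj_on p {1..s - 1}"
    by (rule inj_on_subset[OF bij_betw_imp_inj_on[OF bij]]) auto
  have sub: "p ` {1..s - 1} \<subseteq> T"
    using bij by (auto simp: bij_betw_def)
  have target: "q k \<in> - T \<union> p ` {1..<k}" if "k \<in> {1..s}" for k
  proof -
    have "{1..s} = {1..<k} \<union> {k..s}" using that by auto
    then have "T = p ` {1..<k} \<union> p ` {k..s}"
      using bij by (metis bij_betw_def image_Un)
    then show ?thesis using q[OF that] by blast
  qed
  show ?thesis
  proof (cases "s \<le> 1")
    case True
    with proper show ?thesis by (simp add: interwoven_def s_def)
  next
    case False
    then have "1 \<in> {1..s}" by simp
    from target[OF this] q[OF this] have "q 1 \<in> - T" "A $ p 1 $ q 1 \<noteq> 0" by auto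
    moreover have "\<forall>i\<in>{2..s - 1}. q i \<in> - T \<union> p ` {1..<i} \<and> A $ p i $ q i \<noteq> 0"
    proof
      fix i assume "i \<in> {2..s - 1}"
      then have "i \<in> {1..s}" by auto
      then show "q i \<in> - T \<union> p ` {1..<i} \<and> A $ p i $ q i \<noteq> 0"
        using target q by blast
    qed
    ultimately show ?thesis
      unfolding interwoven_def s_def[symmetric] using proper inj sub False
      by (metis not_le)
  qed
qed

text \<open>The first vertex of the sequence \<open>p\<close> that lies in \<open>U\<close> has an edge out of \<open>U\<close>. If no \<open>p k\<close> lies in
  \<open>U\<close>, then \<open>U\<close> is a singleton, because \<open>p\<close> misses just one vertex of \<open>T\<close>, and \<open>single\<close>
  applies.\<close>

lemma interwoven_edges_leave:
  fixes T :: "'n::finite set"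
  assumes "interwoven A T"
    and single: "\<And>i. i \<in> T \<Longrightarrow> \<exists>j. j \<noteq> i \<and> matrix_edge A i j"
  shows "edges_leave (matrix_edge A) T"
  unfolding edges_leave_def
proof (intro allI impI)
  fix U assume U: "U \<subseteq> T" "U \<noteq> {}"
  define s where "s = card T"
  have singleton: "\<exists>i\<in>U. \<exists>j\<in>- U. matrix_edge A i j" if "card U \<le> 1"
  proof -
    from U(2) have "card U \<noteq> 0" by simp
    with that have "card U = 1" by linarith
    then obtain i where "U = {i}" by (rule card_1_singletonE)
    with U(1) single[of i] show ?thesis by auto
  qed
  show "\<exists>i\<in>U. \<exists>j\<in>- U. matrix_edge A i j"
  proof (cases "s \<le> 1")
    case True
    moreover have "card U \<le> card T" using U(1) by (intro card_mono) auto
    ultimately show ?thesis using singleton by (simp add: s_def)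
  next
    case False
    with assms(1) obtain p q where
      inj: "inj_on p {1..s - 1}" and sub: "p ` {1..s - 1} \<subseteq> T" and
      q1: "q 1 \<in> - T" "A $ p 1 $ q 1 \<noteq> 0" and
      q: "\<And>i. i \<in> {2..s - 1} \<Longrightarrow> q i \<in> - T \<union> p ` {1..<i} \<and> A $ p i $ q i \<noteq> 0"
      unfolding interwoven_def s_def[symmetric] by blast
    have edge: "q k \<in> - T \<union> p ` {1..<k} \<and> A $ p k $ q k \<noteq> 0" if "k \<in> {1..s - 1}" for k
      using that q1 q[of k] by (cases "k = 1") auto
    show ?thesis
    proof (cases "\<exists>k. k \<in> {1..s - 1} \<and> p k \<in> U")
      case True
      define k where "k = (LEAST k. k \<in> {1..s - 1} \<and> p k \<in> U)"
      have k: "k \<in> {1..s - 1}" "p k \<in> U"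
        using LeastI_ex[OF True] by (auto simp: k_def)
      have "p m \<notin> U" if "m \<in> {1..<k}" for m
      proof
        assume "p m \<in> U"
        with that k(1) have "k \<le> m"
          unfolding k_def by (intro Least_le) auto
        with that show False by simp
      qed
      with edge[OF k(1)] U(1) have "q k \<notin> U" by auto
      with edge[OF k(1)] k(2) show ?thesis by blast
    next
      case False
      then have "U \<subseteq> T - p ` {1..s - 1}" using U(1) by auto
      then have "card U \<le> card (T - p ` {1..s - 1})" by (intro card_mono) auto
      also have "\<dots> = s - (s - 1)"
        using sub inj by (simp add: card_Diff_subset card_image s_def)
      also have "\<dots> \<le> 1" by simp
      finally show ?thesis by (rule singleton)
    qed
  qed
qed

section \<open>Scaling to strict diagonal dominance\<close>

lemma H_matrix_iff_scaling:
  fixes A :: "complex ^ 'n ^ 'n::finite"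
  shows "H_matrix A \<longleftrightarrow> (\<exists>d :: 'n \<Rightarrow> real. (\<forall>i. d i > 0) \<and>
    (\<forall>i. (\<Sum>j\<in>UNIV - {i}. norm (A $ i $ j) * d j) < norm (A $ i $ i) * d i))"
proof
  have prod: "(A ** D) $ i $ j = A $ i $ j * D $ j $ j"
    if "pos_diagonal D" for D :: "complex ^ 'n ^ 'n" and i j
  proof -
    have "(A ** D) $ i $ j = (\<Sum>k\<in>UNIV. A $ i $ k * D $ k $ j)"
      by (simp add: matrix_matrix_mult_def)
    also have "\<dots> = (\<Sum>k\<in>UNIV. if k = j then A $ i $ k * D $ k $ j else 0)"
      using that by (intro sum.cong) (auto simp: pos_diagonal_def)
    also have "\<dots> = A $ i $ j * D $ j $ j" by simp
    finally show ?thesis .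
  qed
  { assume "H_matrix A"
    then obtain D where D: "pos_diagonal D" "SDD (A ** D)"
      unfolding H_matrix_def by blast
    have "D $ i $ i \<noteq> 0" for i using D(1) unfolding pos_diagonal_def
      by (metis less_irrefl zero_complex.simps(1))
    with D(2) show "\<exists>d :: 'n \<Rightarrow> real. (\<forall>i. d i > 0) \<and>
      (\<forall>i. (\<Sum>j\<in>UNIV - {i}. norm (A $ i $ j) * d j) < norm (A $ i $ i) * d i)"
      by (intro exI[of _ "\<lambda>i. norm (D $ i $ i)"])
        (simp add: SDD_def row_sum_def prod[OF D(1)] norm_mult) }
  { assume "\<exists>d :: 'n \<Rightarrow> real. (\<forall>i. d i > 0) \<and>
      (\<forall>i. (\<Sum>j\<in>UNIV - {i}. norm (A $ i $ j) * d j) < norm (A $ i $ i) * d i)"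
    then obtain d :: "'n \<Rightarrow> real" where d: "\<And>i. d i > 0"
      "\<And>i. (\<Sum>j\<in>UNIV - {i}. norm (A $ i $ j) * d j) < norm (A $ i $ i) * d i"
      by blast
    define D :: "complex ^ 'n ^ 'n" where
      "D = (\<chi> i j. if i = j then of_real (d i) else 0)"
    have D: "pos_diagonal D" using d(1) by (simp add: pos_diagonal_def D_def)
    have "norm (D $ i $ i) = d i" for i using d(1)[of i] by (simp add: D_def)
    then have "SDD (A ** D)"
      using d(2) by (simp add: SDD_def row_sum_def prod[OF D] norm_mult)
    with D show "H_matrix A" unfolding H_matrix_def by blast }
qed

lemma H_matrix_edges_leave:
  fixes A :: "complex ^ 'n ^ 'n::finite"
  assumes "H_matrix A"
  shows "edges_leave (matrix_edge A) (T_set A)"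
  unfolding edges_leave_def
proof (intro allI impI)
  fix U assume U: "U \<subseteq> T_set A" "U \<noteq> {}"
  obtain d :: "'n \<Rightarrow> real" where d: "\<And>i. d i > 0"
    "\<And>i. (\<Sum>j\<in>UNIV - {i}. norm (A $ i $ j) * d j) < norm (A $ i $ i) * d i"
    using assms unfolding H_matrix_iff_scaling by blast
  obtain i where i: "i \<in> U" "\<And>j. j \<in> U \<Longrightarrow> d i \<le> d j"
    using ex_is_arg_min_if_finite[of U d] U(2) by (auto simp: is_arg_min_linorder)
  show "\<exists>i\<in>U. \<exists>j\<in>- U. matrix_edge A i j"
  proof (rule ccontr)
    assume "\<not> ?thesis"
    then have closed: "A $ i $ j = 0 \<or> j \<in> U" for j using i(1) by blast
    have "row_sum A i * d i = (\<Sum>j\<in>UNIV - {i}. norm (A $ i $ j) * d i)"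
      by (simp add: row_sum_def sum_distrib_right)
    also have "\<dots> \<le> (\<Sum>j\<in>UNIV - {i}. norm (A $ i $ j) * d j)"
    proof (rule sum_mono)
      fix j
      show "norm (A $ i $ j) * d i \<le> norm (A $ i $ j) * d j"
        using closed[of j] i(2)[of j] by (auto intro: mult_left_mono)
    qed
    also have "\<dots> < norm (A $ i $ i) * d i" by (rule d)
    also have "\<dots> \<le> row_sum A i * d i"
      using U(1) i(1) d(1)[of i] by (intro mult_right_mono) (auto simp: T_set_def)
    finally show False by simp
  qed
qed

text \<open>A row \<open>i\<close> in \<open>T(A)\<close> of a DD matrix satisfies \<open>norm (A $ i $ i) = row_sum A i\<close>, so for
  \<open>d j = 1 - \<epsilon> ^ (l j + 1)\<close> the scaled row is strictly dominant as soon as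
  \<open>(\<Sum>j \<noteq> i. norm (A $ i $ j) * \<epsilon> ^ (l j + 1)) > row_sum A i * \<epsilon> ^ (l i + 1)\<close>. A single \<open>j\<close> with
  \<open>l j < l i\<close> contributes at least \<open>norm (A $ i $ j) * \<epsilon> ^ l i\<close>, which suffices when
  \<open>\<epsilon> * row_sum A i < norm (A $ i $ j)\<close>.\<close>

lemma H_matrix_if_rank:
  fixes A :: "complex ^ 'n ^ 'n::finite" and l :: "'n \<Rightarrow> nat"
  assumes DD: "DD A"
    and rank: "\<And>i. i \<in> T_set A \<Longrightarrow> \<exists>j. l j < l i \<and> matrix_edge A i j"
  shows "H_matrix A"
proof -
  have "\<forall>\<^sub>F e in at_right (0::real). 0 < e" "\<forall>\<^sub>F e in at_right (0::real). e < 1"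
    by (auto simp: eventually_at_right_field intro: exI[of _ 1])
  moreover have "\<forall>\<^sub>F e in at_right 0. \<forall>i. i \<notin> T_set A \<longrightarrow> row_sum A i < norm (A $ i $ i) * (1 - e)"
  proof (intro eventually_all_finite)
    fix i
    have "((\<lambda>e. norm (A $ i $ i) * (1 - e)) \<longlongrightarrow> norm (A $ i $ i) * (1 - 0)) (at_right 0)"
      by (intro tendsto_intros)
    from order_tendstoD(1)[OF this, of "row_sum A i"]
    show "\<forall>\<^sub>F e in at_right 0. i \<notin> T_set A \<longrightarrow> row_sum A i < norm (A $ i $ i) * (1 - e)"
      by (cases "i \<in> T_set A") (auto simp: T_set_def)
  qed
  moreover have "\<forall>\<^sub>F e in at_right 0. \<forall>i j. matrix_edge A i j \<longrightarrow> e * row_sum A i < norm (A $ i $ j)"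
  proof (intro eventually_all_finite)
    fix i j
    have "((\<lambda>e. e * row_sum A i) \<longlongrightarrow> 0 * row_sum A i) (at_right 0)"
      by (intro tendsto_intros)
    from order_tendstoD(2)[OF this, of "norm (A $ i $ j)"]
    show "\<forall>\<^sub>F e in at_right 0. matrix_edge A i j \<longrightarrow> e * row_sum A i < norm (A $ i $ j)"
      by (cases "A $ i $ j = 0") auto
  qed
  ultimately have "\<forall>\<^sub>F e in at_right 0. 0 < e \<and> e < 1 \<and>
      (\<forall>i. i \<notin> T_set A \<longrightarrow> row_sum A i < norm (A $ i $ i) * (1 - e)) \<and>
      (\<forall>i j. matrix_edge A i j \<longrightarrow> e * row_sum A i < norm (A $ i $ j))"
    by (intro eventually_conj)
  then obtain e :: real where e: "0 < e" "e < 1"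
    and outside: "\<And>i. i \<notin> T_set A \<Longrightarrow> row_sum A i < norm (A $ i $ i) * (1 - e)"
    and inside: "\<And>i j. matrix_edge A i j \<Longrightarrow> e * row_sum A i < norm (A $ i $ j)"
    using eventually_happens'[OF trivial_limit_at_right_real] by blast
  define d where "d j = 1 - e ^ Suc (l j)" for j
  have pow: "0 < e ^ Suc m" "e ^ Suc m \<le> e" "e ^ Suc m < 1" for m
  proof -
    show "0 < e ^ Suc m" using e by simp
    show "e ^ Suc m \<le> e" using e power_decreasing[of 1 "Suc m" e] by simp
    then show "e ^ Suc m < 1" using e by linarith
  qed
  have "(\<Sum>j\<in>UNIV - {i}. norm (A $ i $ j) * d j) < norm (A $ i $ i) * d i" for i
  proof (cases "i \<in> T_set A")
    case False
    have "(\<Sum>j\<in>UNIV - {i}. norm (A $ i $ j) * d j) \<le> row_sum A i"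
      unfolding row_sum_def
      by (intro sum_mono mult_left_le) (use pow e in \<open>auto simp: d_def less_imp_le\<close>)
    also have "\<dots> < norm (A $ i $ i) * (1 - e)" using False by (rule outside)
    also have "\<dots> \<le> norm (A $ i $ i) * d i"
      using pow(2) by (intro mult_left_mono) (auto simp: d_def)
    finally show ?thesis .
  next
    case True
    then have diag: "norm (A $ i $ i) = row_sum A i"
      using DD by (auto simp: T_set_def DD_def intro: antisym)
    from rank[OF True] obtain j where j: "l j < l i" "A $ i $ j \<noteq> 0" by blast
    have "row_sum A i * e ^ Suc (l i) = (e * row_sum A i) * e ^ l i" by simp
    also have "\<dots> < norm (A $ i $ j) * e ^ l i"
      using inside[OF j(2)] e by (intro mult_strict_right_mono) auto
    also have "\<dots> \<le> norm (A $ i $ j) * e ^ Suc (l j)"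
      using j(1) e by (intro mult_left_mono power_decreasing) auto
    also have "\<dots> \<le> (\<Sum>j\<in>UNIV - {i}. norm (A $ i $ j) * e ^ Suc (l j))"
      by (rule member_le_sum) (use j e in auto)
    finally have "row_sum A i - (\<Sum>j\<in>UNIV - {i}. norm (A $ i $ j) * e ^ Suc (l j))
        < row_sum A i - row_sum A i * e ^ Suc (l i)"
      by linarith
    then show ?thesis
      unfolding diag d_def right_diff_distrib sum_subtractf
      by (simp add: row_sum_def)
  qed
  moreover have "d i > 0" for i using pow by (simp add: d_def)
  ultimately show ?thesis unfolding H_matrix_iff_scaling by blast
qed

section \<open>The characterisation\<close>

theorem theorem8:
  fixes A :: "complex ^ 'n ^ 'n::finite"
  assumes "CARD('n) \<ge> 2"
    and "DD A"
  shows "(H_matrix A \<longleftrightarrow> (\<forall>i. A $ i $ i \<noteq> 0) \<and> interwoven A (T_set A)) \<and>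
    (H_matrix A \<longleftrightarrow>
       T_set A = {} \<or>
       (\<forall>i\<^sub>0\<in>T_set A. \<exists>j\<in>- T_set A. nonzero_chain A i\<^sub>0 j))"
proof -
  let ?leave = "edges_leave (matrix_edge A) (T_set A)"
  have H: "H_matrix A \<longleftrightarrow> ?leave"
    using H_matrix_edges_leave edges_leave_rank[of "T_set A" "matrix_edge A"]
      H_matrix_if_rank[OF \<open>DD A\<close>] by (metis finite)
  have row_sum_pos: "row_sum A i > 0" if "j \<noteq> i" "A $ i $ j \<noteq> 0" for i j
    unfolding row_sum_def by (rule sum_pos2[of _ j]) (use that in auto)
  have "A $ i $ i \<noteq> 0" if leave: ?leave for i
  proof (cases "i \<in> T_set A")
    case True
    with leave obtain j where "j \<noteq> i" "A $ i $ j \<noteq> 0"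
      unfolding edges_leave_def by (elim allE[of _ "{i}"]) auto
    from row_sum_pos[OF this] \<open>DD A\<close> show ?thesis
      unfolding DD_def by (metis norm_zero not_le)
  next
    case False
    moreover have "row_sum A i \<ge> 0" unfolding row_sum_def by (rule sum_nonneg) simp
    ultimately show ?thesis by (auto simp: T_set_def)
  qed
  moreover have ?leave if diag: "\<forall>i. A $ i $ i \<noteq> 0" and "interwoven A (T_set A)"
  proof (rule interwoven_edges_leave[OF that(2)])
    fix i assume "i \<in> T_set A"
    with diag have "row_sum A i > 0"
      unfolding T_set_def by (metis (mono_tags) less_le_trans mem_Collect_eq zero_less_norm_iff)
    then show "\<exists>j. j \<noteq> i \<and> A $ i $ j \<noteq> 0"
      unfolding row_sum_def by (metis (mono_tags) DiffE insertI1 less_irrefl norm_zero sum.neutral)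
  qed
  ultimately have "?leave \<longleftrightarrow> (\<forall>i. A $ i $ i \<noteq> 0) \<and> interwoven A (T_set A)"
    using edges_leave_interwoven by blast
  with H show ?thesis
    using edges_leave_iff_chains[of A "T_set A"] by blast
qed

end
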